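(* Let $n\geq 11$ be a prime. Then there are no integers $x,y$ with $x\neq 0$, $\gcd(x,y)=1$, $y$ even and $7x^2+1=y^n$. *)

theory Defs
  imports "HOL-Computational_Algebra.Primes"
begin

end

(* Write Q_m = (y^m - 1)/(y - 1), so that (y - 1) Q_n = 7 x^2. Since n is coprime to 6, the order
   of y modulo 7 forces 7 | y - 1, and gcd(y - 1, Q_n) is 1 or n.

   If it is 1, then Q_n = b^2. With c = y - 1 and X = y^((n-1)/2) this says (c+1) X^2 - c b^2 = 1,
   and every solution of this equation has X odd, contradicting that y is even.

   If it is n, then y - 1 = 7 n a^2 and Q_n = n b^2, so the Jacobi symbol (Q_m / Q_n) equals the
   Legendre symbol (m / n) for 0 < m < n, while reciprocity and Euclid's algorithm on the indices
   compute (Q_m / Q_n) from y mod 4 alone. For n = 1 (mod 4) we get 4 | y and (Q_m / Q_n) = 1 for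
   all m, which is absurd for a nonresidue m. For n = 3 (mod 4) we get y = 2 (mod 4), and the symbol
   is -1 for m = 2, m = (n-1)/2 and m = n - 1, although the product of the first two is the third. *)
theory Submission
  imports Defs "HOL-Computational_Algebra.Nth_Powers" "HOL-Number_Theory.Number_Theory"
begin

section \<open>The Jacobi symbol\<close>

lemma Legendre_cong:
  assumes "[a = b] (mod p)"
  shows "Legendre a p = Legendre b p"
proof -
  have "[a = 0] (mod p) \<longleftrightarrow> [b = 0] (mod p)"
    using assms by (meson cong_sym cong_trans)
  moreover have "QuadRes p a \<longleftrightarrow> QuadRes p b"
    unfolding QuadRes_def using assms by (meson cong_sym cong_trans)
  ultimately show ?thesis
    by (simp add: Legendre_def)
qed

text \<open>By Euler's criterion both sides are congruent modulo \<open>p\<close>; as each lies in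
  {-1, 0, 1}, they differ by at most 2 < \<open>p\<close>, hence not at all.\<close>

lemma Legendre_mult:
  assumes "prime p" "2 < p"
  shows "Legendre (a * b) (int p) = Legendre a (int p) * Legendre b (int p)"
proof -
  let ?L = "\<lambda>a. Legendre a (int p)"
  have "[?L (a * b) = (a * b) ^ ((p - 1) div 2)] (mod int p)"
    using euler_criterion assms by blast
  also have "(a * b) ^ ((p - 1) div 2) = a ^ ((p - 1) div 2) * b ^ ((p - 1) div 2)"
    by (rule power_mult_distrib)
  also have "[\<dots> = ?L a * ?L b] (mod int p)"
    by (intro cong_mult cong_sym[OF euler_criterion] assms)
  finally have "int p dvd ?L (a * b) - ?L a * ?L b"
    by (simp add: cong_iff_dvd_diff)
  moreover have "\<bar>?L (a * b) - ?L a * ?L b\<bar> \<le> 2"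
  proof -
    have "?L c = -1 \<or> ?L c = 0 \<or> ?L c = 1" for c
      by (simp add: Legendre_def)
    from this[of a] this[of b] this[of "a * b"] show ?thesis
      by (elim disjE) simp_all
  qed
  ultimately have "?L (a * b) - ?L a * ?L b = 0"
    using assms(2) dvd_imp_le_int[of "?L (a * b) - ?L a * ?L b" "int p"] by linarith
  then show ?thesis by simp
qed

text \<open>Primes count with multiplicity. For odd \<open>m\<close> this is the classical Jacobi
  symbol; \<open>m = 0\<close> has no prime factors and yields 1.\<close>

definition jacobi :: "nat \<Rightarrow> nat \<Rightarrow> int" where
  "jacobi a m = (\<Prod>p\<in>#prime_factorization m. Legendre (int a) (int p))"

lemma jacobi_1_right [simp]: "jacobi a (Suc 0) = 1"
  by (simp add: jacobi_def)

lemma jacobi_prime: "prime p \<Longrightarrow> jacobi a p = Legendre (int a) (int p)"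
  by (simp add: jacobi_def prime_factorization_prime)

lemma jacobi_mult_right: "m > 0 \<Longrightarrow> k > 0 \<Longrightarrow> jacobi a (m * k) = jacobi a m * jacobi a k"
  by (simp add: jacobi_def prime_factorization_mult)

lemma jacobi_mult_left:
  assumes "odd m"
  shows "jacobi (a * b) m = jacobi a m * jacobi b m"
proof -
  have "jacobi (a * b) m
      = (\<Prod>p\<in>#prime_factorization m. Legendre (int a) (int p) * Legendre (int b) (int p))"
    unfolding jacobi_def
  proof (intro arg_cong[of _ _ prod_mset] image_mset_cong)
    fix p assume "p \<in># prime_factorization m"
    then have "prime p" "p dvd m" by (auto simp: in_prime_factors_iff)
    with assms have "2 < p"
      by (metis le_neq_implies_less prime_ge_2_nat)
    with \<open>prime p\<close> show "Legendre (int (a * b)) (int p) = Legendre (int a) (int p) * Legendre (int b) (int p)"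
      by (simp add: Legendre_mult)
  qed
  then show ?thesis by (simp add: jacobi_def prod_mset.distrib)
qed

lemma jacobi_cong:
  assumes "[a = b] (mod m)"
  shows "jacobi a m = jacobi b m"
  unfolding jacobi_def
proof (intro arg_cong[of _ _ prod_mset] image_mset_cong Legendre_cong)
  fix p assume "p \<in># prime_factorization m"
  then have "p dvd m" by (auto simp: in_prime_factors_iff)
  with assms show "[int a = int b] (mod int p)"
    by (simp add: cong_int_iff cong_dvd_modulus_nat)
qed

text \<open>Odd numbers are built up one odd prime at a time, so that multiplicativity reduces
  claims about the symbol to prime arguments.\<close>

lemma odd_prime_induct [consumes 1, case_names one mult]:
  fixes m :: nat
  assumes "odd m" "P 1"
    and "\<And>p k. prime p \<Longrightarrow> 2 < p \<Longrightarrow> odd k \<Longrightarrow> P k \<Longrightarrow> P (p * k)"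
  shows "P m"
  using assms(1)
proof (induction m rule: prime_divisors_induct)
  case (unit x)
  then show ?case using assms(2) by simp
next
  case (factor p x)
  then have "2 < p"
    using prime_ge_2_nat[of p] by (cases "p = 2") auto
  with factor assms(3) show ?case by simp
qed simp

lemma jacobi_coprime:
  assumes "odd m" "coprime a m"
  shows "jacobi a m = 1 \<or> jacobi a m = -1"
  using assms
proof (induction m rule: odd_prime_induct)
  case (mult p k)
  then have "\<not> p dvd a"
    by (meson coprime_common_divisor dvd_triv_left not_prime_unit)
  then have "\<not> [int a = 0] (mod int p)"
    by (simp add: cong_0_iff)
  then have "jacobi a p = 1 \<or> jacobi a p = -1"
    using mult by (simp add: jacobi_prime Legendre_def)
  moreover have "jacobi a k = 1 \<or> jacobi a k = -1"
    using mult by auto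
  moreover have "jacobi a (p * k) = jacobi a p * jacobi a k"
    using mult by (intro jacobi_mult_right) (auto intro: odd_pos)
  ultimately show ?case by auto
qed simp

lemma jacobi_1_left [simp]: "jacobi (Suc 0) m = 1"
proof -
  have "Legendre 1 (int p) = 1" if "prime p" for p
  proof -
    have "\<not> [1 = 0] (mod int p)"
      using that by (auto simp: cong_0_iff)
    moreover have "QuadRes (int p) 1"
      unfolding QuadRes_def by (rule exI[of _ 1]) simp
    ultimately show ?thesis by (simp add: Legendre_def)
  qed
  then have "image_mset (\<lambda>p. Legendre 1 (int p)) (prime_factorization m) = image_mset (\<lambda>p. 1) (prime_factorization m)"
    by (intro image_mset_cong) (auto simp: in_prime_factors_iff)
  then show ?thesis by (simp add: jacobi_def)
qed

text \<open>For odd arguments this is the usual (-1)^((m-1)/2 * (n-1)/2), phrased through residues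
  modulo 4 because those are what is known of repunits.\<close>

definition reciprocity_sign :: "nat \<Rightarrow> nat \<Rightarrow> int" where
  "reciprocity_sign m n = (if m mod 4 = 3 \<and> n mod 4 = 3 then -1 else 1)"

lemma odd_mod_4: "odd (m::nat) \<Longrightarrow> m mod 4 = 1 \<or> m mod 4 = 3"
  by presburger

lemma reciprocity_sign_mult:
  assumes "odd a" "odd b"
  shows "reciprocity_sign (a * b) n = reciprocity_sign a n * reciprocity_sign b n"
proof -
  have "(a * b) mod 4 = ((a mod 4) * (b mod 4)) mod 4" by (simp add: mod_mult_eq)
  then show ?thesis using assms[THEN odd_mod_4] by (auto simp: reciprocity_sign_def)
qed

lemma reciprocity_sign_commute: "reciprocity_sign m n = reciprocity_sign n m"
  by (simp add: reciprocity_sign_def)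

lemma reciprocity_sign_eq_power:
  assumes "odd m" "odd n"
  shows "(-1) ^ ((m - 1) div 2 * ((n - 1) div 2)) = reciprocity_sign m n"
proof -
  have "even ((k - 1) div 2) \<longleftrightarrow> k mod 4 \<noteq> 3" if "odd k" for k :: nat
    using that by presburger
  with assms show ?thesis by (simp add: reciprocity_sign_def minus_one_power_iff)
qed

text \<open>First stage of reciprocity: one argument stays prime while the other is split into
  primes, each handled by the law for Legendre symbols.\<close>

lemma jacobi_reciprocity_prime:
  assumes "prime p" "2 < p" "odd m" "coprime m p"
  shows "jacobi m p * jacobi p m = reciprocity_sign m p"
  using assms(3,4)
proof (induction m rule: odd_prime_induct)
  case one
  then show ?case using assms by (simp add: reciprocity_sign_def)
next
  case (mult q k)
  have "odd p" using assms by (simp add: prime_odd_nat)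
  have "odd q" using mult by (simp add: prime_odd_nat)
  have "p \<noteq> q" using mult assms by auto
  have "jacobi (q * k) p * jacobi p (q * k) = (jacobi q p * jacobi p q) * (jacobi k p * jacobi p k)"
    using mult \<open>odd p\<close> by (simp add: jacobi_mult_left jacobi_mult_right odd_pos prime_gt_0_nat)
  also have "jacobi q p * jacobi p q = reciprocity_sign q p"
    using Quadratic_Reciprocity[of q p] mult.hyps(1,2) assms(1,2) \<open>p \<noteq> q\<close>
      reciprocity_sign_eq_power[OF \<open>odd q\<close> \<open>odd p\<close>]
    by (simp add: jacobi_prime)
  also have "jacobi k p * jacobi p k = reciprocity_sign k p"
    using mult by simp
  finally show ?case
    using mult \<open>odd q\<close> by (simp add: reciprocity_sign_mult)
qed

text \<open>Second stage: now \<open>m\<close> is split into primes \<open>q\<close>, and the first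
  stage applies to the pair \<open>n\<close>, \<open>q\<close>.\<close>

theorem jacobi_reciprocity:
  assumes "odd m" "odd n" "coprime m n"
  shows "jacobi m n * jacobi n m = reciprocity_sign m n"
  using assms(1,3)
proof (induction m rule: odd_prime_induct)
  case one
  then show ?case by (simp add: reciprocity_sign_def)
next
  case (mult q k)
  have "odd q" using mult by (simp add: prime_odd_nat)
  have "jacobi (q * k) n * jacobi n (q * k) = (jacobi n q * jacobi q n) * (jacobi k n * jacobi n k)"
    using mult \<open>odd n\<close> by (simp add: jacobi_mult_left jacobi_mult_right odd_pos prime_gt_0_nat)
  also have "jacobi n q * jacobi q n = reciprocity_sign n q"
    using mult assms by (intro jacobi_reciprocity_prime) (auto simp: coprime_commute)
  also have "jacobi k n * jacobi n k = reciprocity_sign k n"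
    using mult by simp
  finally show ?case
    using mult \<open>odd q\<close> by (simp add: reciprocity_sign_mult reciprocity_sign_commute[of n q])
qed

text \<open>Both symbols are 1 or -1, so the product formula can be solved for either one.\<close>

lemma jacobi_flip:
  assumes "odd m" "odd n" "coprime m n"
  shows "jacobi m n = reciprocity_sign m n * jacobi n m"
  using jacobi_reciprocity[OF assms] jacobi_coprime[of m n] assms
    jacobi_coprime[of n m] by (auto simp: coprime_commute reciprocity_sign_def split: if_splits)

text \<open>Otherwise squaring would map the finite set of nonzero residues onto itself, hence
  injectively, although 1 and \<open>p - 1\<close> have the same square.\<close>

lemma quadratic_nonresidue_exists:
  assumes "prime p" "2 < p"
  shows "\<exists>m. 0 < m \<and> m < p \<and> Legendre (int m) (int p) = -1"
proof (rule ccontr)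
  assume none: "\<not> ?thesis"
  let ?S = "{0<..<p}" and ?f = "\<lambda>x. x\<^sup>2 mod p"
  have "?S \<subseteq> ?f ` ?S"
  proof
    fix m assume m: "m \<in> ?S"
    then have ndvd: "\<not> p dvd m" by (auto dest: dvd_imp_le)
    with none m have "QuadRes (int p) (int m)"
      by (auto simp: Legendre_def cong_0_iff split: if_splits)
    then obtain z where z: "[z\<^sup>2 = int m] (mod int p)" unfolding QuadRes_def by blast
    \<comment> \<open>The integer root \<open>z\<close> is replaced by its least nonnegative
      residue, which is nonzero because its square is \<open>m\<close>.\<close>
    define w where "w = nat (z mod int p)"
    have w: "int w = z mod int p" using assms by (simp add: w_def)
    have "[(int w)\<^sup>2 = int m] (mod int p)"
      using z unfolding w by (simp add: cong_def power_mod)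
    then have "[w\<^sup>2 = m] (mod p)"
      by (metis cong_int_iff of_nat_power)
    then have fw: "?f w = m" using m by (simp add: cong_def)
    have "int w < int p" using assms by (simp add: w)
    moreover have "w > 0" using fw m by (intro Nat.gr0I) auto
    ultimately show "m \<in> ?f ` ?S" using fw by auto
  qed
  then have "inj_on ?f ?S"
    by (metis card_image_le card_mono eq_card_imp_inj_on finite_greaterThanLessThan finite_imageI le_antisym)
  moreover have "?f 1 = ?f (p - 1)"
  proof -
    have "(p - 1)\<^sup>2 = 1 + p * (p - 2)"
    proof -
      obtain k where "p = k + 2" using assms by (metis add.commute le_Suc_ex less_imp_le)
      then show ?thesis by (simp add: power2_eq_square algebra_simps)
    qed
    then show ?thesis by (metis mod_mult_self2 one_power2)
  qed
  ultimately have "1 = p - 1" using assms by (auto dest!: inj_onD[of ?f ?S 1 "p - 1"])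
  with assms show False by simp
qed

section \<open>Repunits in an even base\<close>

text \<open>The quotient (y^m - 1)/(y - 1), written as a geometric sum to avoid division.\<close>

definition repunit :: "nat \<Rightarrow> nat \<Rightarrow> nat" where
  "repunit y m = (\<Sum>i<m. y ^ i)"

lemma repunit_1 [simp]: "repunit y (Suc 0) = 1"
  by (simp add: repunit_def)

lemma repunit_Suc: "repunit y (Suc m) = 1 + y * repunit y m"
  by (simp add: repunit_def sum.lessThan_Suc_shift sum_distrib_left del: sum.lessThan_Suc)

lemma repunit_add: "repunit y (m + k) = repunit y m + y ^ m * repunit y k"
  by (induction m) (simp_all add: repunit_Suc algebra_simps, simp add: repunit_def)

lemma repunit_power: "y > 0 \<Longrightarrow> y ^ m = 1 + (y - 1) * repunit y m"
proof (induction m)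
  case (Suc m)
  then obtain c where "y = c + 1" by (metis Suc_eq_plus1 gr0_implies_Suc)
  with Suc show ?case by (simp add: repunit_Suc algebra_simps)
qed (simp add: repunit_def)

lemma repunit_cong_exponent: "[y = 1] (mod k) \<Longrightarrow> [repunit y m = m] (mod k)"
proof -
  assume "[y = 1] (mod k)"
  then have "[(\<Sum>i<m. y ^ i) = (\<Sum>i<m. 1)] (mod k)"
    by (intro cong_sum) (metis cong_pow power_one)
  then show ?thesis by (simp add: repunit_def)
qed

text \<open>Modulo \<open>repunit y n\<close> the power \<open>y ^ n\<close> is 1, so
  \<open>n\<close> may be subtracted from an index: the Euclidean step.\<close>

lemma repunit_reduce: "y > 0 \<Longrightarrow> [repunit y (m + n) = repunit y m] (mod repunit y n)"
proof -
  assume "y > 0"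
  have "repunit y (m + n) = repunit y n + y ^ n * repunit y m"
    by (metis add.commute repunit_add)
  also have "\<dots> = repunit y m + repunit y n * (1 + (y - 1) * repunit y m)"
    by (subst repunit_power[OF \<open>y > 0\<close>]) (simp add: algebra_simps)
  finally show ?thesis by (metis cong_def mod_mult_self2)
qed

lemma odd_repunit: "even y \<Longrightarrow> m > 0 \<Longrightarrow> odd (repunit y m)"
  by (cases m) (auto simp: repunit_Suc)

text \<open>The subtractive Euclidean algorithm on the indices, by induction on their sum; it ends
  with indices 0 and 1.\<close>

lemma coprime_repunit:
  assumes "y > 0" "coprime m n"
  shows "coprime (repunit y m) (repunit y n)"
  using assms(2)
proof (induction "m + n" arbitrary: m n rule: less_induct)
  case less
  have step: "coprime (repunit y a) (repunit y b)"
    if "b \<le> a" "0 < b" "a + b = m + n" "coprime a b" for a b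
  proof -
    have "coprime (repunit y (a - b)) (repunit y b)"
    proof (rule less(1))
      show "a - b + b < m + n" using that by simp
      show "coprime (a - b) b" using that by (metis gcd_diff1_nat coprime_iff_gcd_eq_1)
    qed
    then show ?thesis
      using repunit_reduce[OF \<open>y > 0\<close>, of "a - b" b] that
      by (metis cong_imp_coprime cong_sym le_add_diff_inverse2)
  qed
  consider "n = 0" | "m = 0" | "0 < n" "n \<le> m" | "0 < m" "m \<le> n" by linarith
  then show ?case
  proof cases
    case 3
    then show ?thesis using step less.prems by simp
  next
    case 4
    then show ?thesis using step[of m n] less.prems by (simp add: coprime_commute add.commute)
  qed (use less.prems in auto)
qed

lemma repunit_mod_4_eq_1:
  assumes "y mod 4 = 0" "m > 0"
  shows "repunit y m mod 4 = 1"
proof -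
  obtain k where "m = Suc k" using assms by (cases m) auto
  moreover from assms obtain z where "y = 4 * z" by auto
  ultimately show ?thesis by (simp add: repunit_Suc mult.assoc)
qed

text \<open>Since 4 divides \<open>y\<^sup>2\<close>, only the terms 1 and \<open>y\<close> survive
  modulo 4.\<close>

lemma repunit_mod_4_eq_3:
  assumes "y mod 4 = 2" "m \<ge> 2"
  shows "repunit y m mod 4 = 3"
proof -
  obtain k where k: "m = Suc (Suc k)" using assms
    by (metis add_2_eq_Suc le_Suc_ex)
  have "odd (repunit y (Suc k))" using assms by (intro odd_repunit) (presburger, simp)
  then obtain r where "repunit y (Suc k) = 2 * r + 1" by (rule oddE)
  then have "repunit y m = 1 + y + 2 * r * y" by (simp add: k repunit_Suc[of y "Suc k"] algebra_simps)
  moreover obtain z where "y = 4 * z + 2" using assms by (metis mult_div_mod_eq)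
  ultimately have "repunit y m = 3 + 4 * (z + 2 * r * z + r)" by (simp add: algebra_simps)
  then show ?thesis by (simp only: mod_mult_self2) simp
qed

section \<open>Jacobi symbols between repunits\<close>

lemma jacobi_repunit_reduce:
  "y > 0 \<Longrightarrow> jacobi (repunit y (m + n)) (repunit y n) = jacobi (repunit y m) (repunit y n)"
  by (intro jacobi_cong repunit_reduce)

lemma jacobi_repunit_reduce_mult:
  "y > 0 \<Longrightarrow> jacobi (repunit y (m + k * n)) (repunit y n) = jacobi (repunit y m) (repunit y n)"
proof (induction k)
  case (Suc k)
  have "m + Suc k * n = (m + k * n) + n" by simp
  with Suc show ?case by (metis jacobi_repunit_reduce)
qed simp

text \<open>All repunits involved are 1 modulo 4, so flipping costs no sign and Euclid's algorithm
  runs freely down to equal indices, which coprimality forces to be 1.\<close>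

lemma jacobi_repunit_eq_1:
  assumes "y > 0" "y mod 4 = 0" "m > 0" "n > 0" "coprime m n"
  shows "jacobi (repunit y m) (repunit y n) = 1"
  using assms(3-5)
proof (induction "m + n" arbitrary: m n rule: less_induct)
  case less
  have "even y" using assms by presburger
  have step: "jacobi (repunit y a) (repunit y b) = 1"
    if "b < a" "0 < b" "a + b = m + n" "coprime a b" for a b
  proof -
    have "jacobi (repunit y (a - b)) (repunit y b) = 1"
    proof (rule less(1))
      show "a - b + b < m + n" "0 < a - b" "0 < b" using that by simp_all
      show "coprime (a - b) b" using that by (metis gcd_diff1_nat coprime_iff_gcd_eq_1 less_imp_le)
    qed
    then show ?thesis
      using jacobi_repunit_reduce[OF \<open>y > 0\<close>, of "a - b" b] that(1) by simp
  qed
  consider "n = m" | "n < m" | "m < n" by linarith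
  then show ?case
  proof cases
    case 1
    then show ?thesis using less.prems by simp
  next
    case 2
    then show ?thesis using step less.prems by simp
  next
    case 3
    have "jacobi (repunit y m) (repunit y n) =
        reciprocity_sign (repunit y m) (repunit y n) * jacobi (repunit y n) (repunit y m)"
      using less.prems \<open>even y\<close> assms(1)
      by (intro jacobi_flip odd_repunit coprime_repunit) auto
    also have "jacobi (repunit y n) (repunit y m) = 1"
      using step[of m n] less.prems 3 by (simp add: coprime_commute)
    also have "reciprocity_sign (repunit y m) (repunit y n) = 1"
      using assms less.prems by (simp add: reciprocity_sign_def repunit_mod_4_eq_1)
    finally show ?thesis by simp
  qed
qed

text \<open>Both repunits are 3 modulo 4, so one flip contributes -1; then the index
  \<open>1 + k * m\<close> reduces to 1 and the remaining symbol is trivial.\<close>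

lemma jacobi_repunit_eq_minus_1:
  assumes "y mod 4 = 2" "m \<ge> 2" "k > 0"
  shows "jacobi (repunit y m) (repunit y (1 + k * m)) = -1"
proof -
  have "y > 0" "even y" using assms by presburger+
  have "m \<le> k * m" using assms(3) by simp
  with assms have n: "2 \<le> 1 + k * m" by simp
  have "coprime m (1 + k * m)"
    using gcd_add_mult[of m k 1] unfolding coprime_iff_gcd_eq_1 by (subst add.commute) simp
  have "jacobi (repunit y m) (repunit y (1 + k * m)) = reciprocity_sign (repunit y m) (repunit y (1 + k * m))
      * jacobi (repunit y (1 + k * m)) (repunit y m)"
    using assms \<open>even y\<close> \<open>y > 0\<close> \<open>coprime m (1 + k * m)\<close>
    by (intro jacobi_flip odd_repunit coprime_repunit) auto
  also have "jacobi (repunit y (1 + k * m)) (repunit y m) = 1"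
    using jacobi_repunit_reduce_mult[OF \<open>y > 0\<close>, of 1 k m] by simp
  also have "reciprocity_sign (repunit y m) (repunit y (1 + k * m)) = -1"
    using assms n by (simp add: reciprocity_sign_def repunit_mod_4_eq_3)
  finally show ?thesis by simp
qed

text \<open>The square \<open>b\<^sup>2\<close> does not affect the symbol, and \<open>repunit y m\<close> is congruent to \<open>m\<close> modulo \<open>n\<close>.\<close>

lemma jacobi_repunit_eq_Legendre:
  assumes "prime n" "n > 2" "y > 0" "[y = 1] (mod n)" "repunit y n = n * b\<^sup>2" "even y"
    and "0 < m" "m < n"
  shows "jacobi (repunit y m) (repunit y n) = Legendre (int m) (int n)"
proof -
  have "coprime m n"
    using assms by (metis coprime_commute nat_dvd_not_less prime_imp_coprime)
  then have "coprime (repunit y m) (n * b\<^sup>2)"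
    using coprime_repunit assms by metis
  moreover have "odd (n * b\<^sup>2)" using odd_repunit[of y n] assms by simp
  ultimately have b: "coprime (repunit y m) b" "odd b" by auto
  then have "b > 0" by (auto intro: odd_pos)
  have "jacobi (repunit y m) (repunit y n) = jacobi (repunit y m) n * (jacobi (repunit y m) b)\<^sup>2"
    using assms \<open>b > 0\<close> by (simp add: jacobi_mult_right power2_eq_square prime_gt_0_nat)
  also have "(jacobi (repunit y m) b)\<^sup>2 = 1"
    using jacobi_coprime[OF b(2,1)] by auto
  also have "jacobi (repunit y m) n = jacobi m n"
    using assms by (intro jacobi_cong repunit_cong_exponent)
  finally show ?thesis using assms by (simp add: jacobi_prime)
qed

text \<open>The condition on \<open>y mod 4\<close> is what \<open>y = 1 + 7 * n * a\<^sup>2\<close>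
  with \<open>a\<close> odd provides. It makes \<open>y\<close> 0 or 2 modulo 4 according to whether
  \<open>n\<close> is 1 or 3.\<close>

lemma repunit_neq_prime_mult_square:
  assumes "prime n" "n > 5" "y > 0" "[y = 1] (mod n)" "y mod 4 = (1 + 3 * n) mod 4"
  shows "repunit y n \<noteq> n * b\<^sup>2"
proof
  assume eq: "repunit y n = n * b\<^sup>2"
  have "odd n" using assms by (simp add: prime_odd_nat)
  have y_mod_4: "y mod 4 = (1 + 3 * (n mod 4)) mod 4"
    unfolding assms(5) by (metis mod_add_right_eq mod_mult_right_eq)
  from \<open>odd n\<close> consider "n mod 4 = 1" | "n mod 4 = 3" using odd_mod_4 by blast
  then show False
  proof cases
    case 1
    then have y: "y mod 4 = 0" by (simp add: y_mod_4)
    then have "even y" by presburger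
    obtain m where m: "0 < m" "m < n" "Legendre (int m) (int n) = -1"
      using quadratic_nonresidue_exists[of n] assms by auto
    have "coprime m n"
      using m assms(1) by (metis coprime_commute nat_dvd_not_less prime_imp_coprime)
    then have "jacobi (repunit y m) (repunit y n) = 1"
      using assms y m by (intro jacobi_repunit_eq_1) auto
    then show False
      using jacobi_repunit_eq_Legendre[OF assms(1) _ assms(3,4) eq \<open>even y\<close> m(1,2)] m assms by simp
  next
    case 2
    then have y: "y mod 4 = 2" by (simp add: y_mod_4)
    then have "even y" by presburger
    define h where "h = (n - 1) div 2"
    \<comment> \<open>The two spellings exhibit \<open>n\<close> as 1 plus a multiple of 2 and of
      \<open>h\<close>, the shape needed for the symbol to be -1.\<close>
    have n2: "n = 1 + h * 2" and nh: "n = 1 + 2 * h" and h: "h \<ge> 2" "h < n"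
      using \<open>odd n\<close> assms(2) unfolding h_def by presburger+
    have L: "Legendre (int m) (int n) = jacobi (repunit y m) (repunit y n)" if "0 < m" "m < n" for m
      using jacobi_repunit_eq_Legendre[OF assms(1) _ assms(3,4) eq \<open>even y\<close> that] assms by simp
    have "Legendre 2 (int n) = -1"
      using L[of 2] jacobi_repunit_eq_minus_1[OF y, of 2 h] h assms(2) n2 by simp
    moreover have "Legendre (int h) (int n) = -1"
      using L[of h] jacobi_repunit_eq_minus_1[OF y h(1), of 2] h nh by simp
    moreover have "Legendre (int (n - 1)) (int n) = Legendre 2 (int n) * Legendre (int h) (int n)"
      using Legendre_mult[OF assms(1), of 2 "int h"] assms(2) nh by simp
    moreover have "Legendre (int (n - 1)) (int n) = -1"
      using L[of "n - 1"] jacobi_repunit_eq_minus_1[OF y, of "n - 1" 1] assms(2) by simp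
    ultimately show False by simp
  qed
qed

section \<open>The Pell-type equation\<close>

text \<open>Multiplication by the unit \<open>(\<surd>(c + 1) - \<surd>c)\<^sup>2\<close> descends to the trivial solution
  \<open>X = 1\<close> without changing the parity of \<open>X\<close>.\<close>

lemma pell_odd:
  fixes c X b :: int
  assumes "c > 0" "X \<ge> 0" "b \<ge> 0" "(c + 1) * X\<^sup>2 = c * b\<^sup>2 + 1"
  shows "odd X"
  using assms(2-4)
proof (induction "nat X" arbitrary: X b rule: less_induct)
  case less
  have "c * b\<^sup>2 + 1 > 0" using assms(1) by (simp add: add_nonneg_pos)
  with less.prems have "X \<noteq> 0" by auto
  show ?case
  proof (cases "X = 1")
    case False
    with less.prems \<open>X \<noteq> 0\<close> have "X > 1" by simp
    \<comment> \<open>These are the coefficients of (X sqrt(c+1) + b sqrt c)(2c + 1 - 2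
      sqrt(c(c+1))), the second factor being the squared unit.\<close>
    define X' where "X' = (2 * c + 1) * X - 2 * c * b"
    define b' where "b' = (2 * c + 1) * b - 2 * (c + 1) * X"
    \<comment> \<open>\<open>X' < X\<close> amounts to \<open>X < b\<close>, and
      \<open>- X < X'\<close> to \<open>c * b < (c + 1) * X\<close>; both follow from the
      equation.\<close>
    have "X * X > 1" using \<open>X > 1\<close> by (metis less_1_mult)
    then have "c * X\<^sup>2 < c * b\<^sup>2" using less.prems by (simp add: power2_eq_square algebra_simps)
    then have "X\<^sup>2 < b\<^sup>2" using assms(1) by simp
    then have "X < b" using less.prems by (simp add: power_less_imp_less_base)
    then have "c * X < c * b" using assms(1) by simp
    then have lt: "X' < X" by (simp add: X'_def algebra_simps)
    have "(c * b)\<^sup>2 = c * ((c + 1) * X\<^sup>2 - 1)" using less.prems by (simp add: power2_eq_square)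
    also have "\<dots> < c * ((c + 1) * X\<^sup>2)" using assms(1) by simp
    also have "\<dots> \<le> (c + 1) * ((c + 1) * X\<^sup>2)" using assms(1) by (intro mult_right_mono) auto
    also have "\<dots> = ((c + 1) * X)\<^sup>2" by (simp add: power2_eq_square)
    finally have "c * b < (c + 1) * X"
      by (rule power_less_imp_less_base) (use assms(1) less.prems in auto)
    then have gt: "- X < X'" by (simp add: X'_def algebra_simps)
    have "(c + 1) * X'\<^sup>2 - c * b'\<^sup>2 = (c + 1) * X\<^sup>2 - c * b\<^sup>2"
      by (simp add: X'_def b'_def power2_eq_square algebra_simps)
    \<comment> \<open>\<open>X'\<close> and \<open>b'\<close> may be negative, so the induction
      hypothesis is applied to absolute values.\<close>
    then have "(c + 1) * \<bar>X'\<bar>\<^sup>2 = c * \<bar>b'\<bar>\<^sup>2 + 1" using less.prems by simp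
    moreover have "nat \<bar>X'\<bar> < nat X" using lt gt \<open>X > 1\<close> by simp
    ultimately have "odd \<bar>X'\<bar>" using less(1) by (metis abs_ge_zero)
    then show ?thesis by (simp add: X'_def)
  qed simp
qed

lemma repunit_neq_square:
  assumes "even y" "y > 0" "odd n" "n > 1"
  shows "repunit y n \<noteq> b\<^sup>2"
proof
  assume eq: "repunit y n = b\<^sup>2"
  define k where "k = (n - 1) div 2"
  \<comment> \<open>Writing \<open>y ^ n\<close> as \<open>y * (y ^ k)\<^sup>2\<close> gives the
    Pell-type equation with \<open>X = y ^ k\<close>, which is even because
    \<open>k > 0\<close>.\<close>
  have n: "n = Suc (2 * k)" "k > 0" using assms unfolding k_def by presburger+
  obtain c where c: "y = c + 1" by (metis Suc_eq_plus1 assms(2) gr0_implies_Suc)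
  with assms(1) have "c > 0" by (cases c) auto
  have "y * (y ^ k)\<^sup>2 = y ^ n" by (simp add: n power_even_eq)
  also have "\<dots> = c * b\<^sup>2 + 1" using repunit_power[OF assms(2), of n] unfolding eq by (simp add: c)
  finally have "int (y * (y ^ k)\<^sup>2) = int (c * b\<^sup>2 + 1)" by (rule arg_cong)
  then have "(int c + 1) * (int (y ^ k))\<^sup>2 = int c * (int b)\<^sup>2 + 1"
    by (simp add: c algebra_simps)
  then have "odd (int (y ^ k))"
    using \<open>c > 0\<close> by (intro pell_odd[of "int c" _ "int b"]) auto
  then show False using assms(1) n by simp
qed

section \<open>The equation\<close>

lemma no_solution_nat:
  fixes n x y :: nat
  assumes "prime n" "n \<ge> 11" "even y" "y > 0" "7 * x\<^sup>2 + 1 = y ^ n" "x > 0"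
  shows False
proof -
  let ?Q = "repunit y n"
  have "odd n" using assms by (simp add: prime_odd_nat)
  have prod: "(y - 1) * ?Q = 7 * x\<^sup>2"
    using repunit_power[OF assms(4), of n] assms(5) by simp
  have "coprime n 6"
  proof -
    have "\<not> n dvd 6" using assms by (auto dest: dvd_imp_le)
    then show ?thesis using assms(1) prime_imp_coprime by blast
  qed
  have "[y ^ n = 1] (mod 7)"
    by (simp add: cong_def flip: assms(5))
  \<comment> \<open>The order divides both \<open>n\<close> and \<open>totient 7 = 6\<close>, which
    are coprime, so it is 1.\<close>
  then have "ord 7 y dvd n" by (simp only: ord_divides)
  moreover have "coprime 7 y"
    using \<open>[y ^ n = 1] (mod 7)\<close> assms
    by (metis cong_imp_coprime cong_sym coprime_1_left coprime_commute coprime_power_left_iff not_numeral_le_zero)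
  then have "ord 7 y dvd totient 7" by (rule order_divides_totient)
  moreover have "totient 7 = 6" using totient_prime[of 7] by simp
  ultimately have "ord 7 y = 1" using \<open>coprime n 6\<close> by (metis coprime_common_divisor_nat)
  then have "[y = 1] (mod 7)" by (metis One_nat_def ord_eq_Suc_0_iff)
  then have "7 dvd y - 1" by (rule cong_to_1_nat)
  then obtain u where u: "y - 1 = 7 * u" by (elim dvdE)
  with prod have uQ: "u * ?Q = x\<^sup>2" by simp
  then have "u > 0" "?Q > 0" using assms(6) by (auto intro: Nat.gr0I)
  \<comment> \<open>Since \<open>y\<close> is 1 modulo \<open>y - 1\<close>, the repunit is
    \<open>n\<close> modulo \<open>y - 1\<close>, so the two factors share at most the prime
    \<open>n\<close>.\<close>
  have "[1 + (y - 1) = 1] (mod y - 1)" by (simp only: cong_def mod_add_self2)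
  then have "[?Q = n] (mod y - 1)" using assms(4) by (intro repunit_cong_exponent) simp
  then have gcd: "gcd ?Q (y - 1) = gcd n (y - 1)" by (rule cong_gcd_eq)
  show False
  proof (cases "n dvd y - 1")
    case False
    then have "coprime ?Q (y - 1)"
      using gcd assms(1) by (metis coprime_iff_gcd_eq_1 prime_imp_coprime)
    then have "coprime u ?Q" unfolding u by (simp add: coprime_commute)
    then obtain b where "?Q = b\<^sup>2"
      using is_nth_power_mult_coprime_natD(2)[of u ?Q 2] uQ \<open>u > 0\<close> \<open>?Q > 0\<close>
      by (auto simp: is_nth_power_def)
    then show False using repunit_neq_square assms \<open>odd n\<close> by simp
  next
    case True
    have "coprime n 7"
    proof -
      have "\<not> n dvd 7" using assms by (auto dest: dvd_imp_le)
      then show ?thesis using assms(1) prime_imp_coprime by blast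
    qed
    with True have "n dvd u" unfolding u by (simp add: coprime_dvd_mult_right_iff)
    then obtain v where v: "u = n * v" by (elim dvdE)
    have gn: "gcd ?Q (y - 1) = n" using gcd True by (simp add: gcd_proj1_if_dvd_nat)
    then have "n dvd ?Q" by (metis gcd_dvd1)
    then obtain w where w: "?Q = n * w" by (elim dvdE)
    have "n dvd x" using uQ v assms(1) by (metis dvd_mult2 dvd_triv_left prime_dvd_power)
    then obtain z where z: "x = n * z" by (elim dvdE)
    have "n * n * (v * w) = n * n * z\<^sup>2"
      using uQ unfolding v w z by (simp add: power2_eq_square ac_simps)
    then have vw: "v * w = z\<^sup>2" using assms(2) by simp
    \<comment> \<open>The gcd of the two factors is exactly \<open>n\<close>; cancelling it leaves
      \<open>v\<close> and \<open>w\<close> coprime with square product, hence both squares.\<close>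
    have "n * gcd w (7 * v) = n * 1"
      using gn unfolding w u v by (simp add: gcd_mult_distrib_nat ac_simps)
    then have "gcd w (7 * v) = 1" using assms(2) by simp
    then have "coprime w (7 * v)" by (simp only: coprime_iff_gcd_eq_1)
    then have "coprime v w" by (simp add: coprime_commute)
    moreover have "v > 0" "w > 0" using \<open>u > 0\<close> \<open>?Q > 0\<close> v w by auto
    ultimately obtain a b where a: "v = a\<^sup>2" and b: "w = b\<^sup>2"
      using is_nth_power_mult_coprime_natD[of v w 2] vw by (auto simp: is_nth_power_def)
    have y: "y = 1 + 7 * n * a\<^sup>2" using u v a assms(4) by simp
    have "odd (a\<^sup>2)" using y assms(3) by (metis even_add even_mult_iff odd_one)
    then have "odd a" by simp
    then obtain r where "a = 2 * r + 1" by (rule oddE)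
    \<comment> \<open>Here \<open>a\<^sup>2 = 4 * (r\<^sup>2 + r) + 1\<close> and 7 is 3 modulo
      4.\<close>
    then have "y = (1 + 3 * n) + 4 * (n + 7 * n * (r\<^sup>2 + r))"
      by (simp add: y power2_eq_square algebra_simps)
    then have "y mod 4 = (1 + 3 * n) mod 4" by (metis mod_mult_self2)
    moreover have "y = 1 + n * (7 * a\<^sup>2)" by (simp add: y)
    then have "[y = 1] (mod n)" by (simp only: cong_def mod_mult_self2)
    ultimately show False
      using repunit_neq_prime_mult_square[OF assms(1), of y b] assms w b by simp
  qed
qed

theorem theorem6p1:
  fixes n :: nat
  assumes "prime n" and "n \<ge> 11"
  shows "\<not> (\<exists>x y :: int. x \<noteq> 0 \<and> gcd x y = 1 \<and> even y \<and> 7 * x^2 + 1 = y^n)"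
proof (intro notI, elim exE conjE)
  fix x y :: int
  assume xy: "x \<noteq> 0" "even y" "7 * x^2 + 1 = y^n"
  have "odd n" using assms by (simp add: prime_odd_nat)
  \<comment> \<open>The odd exponent passes positivity from \<open>y ^ n\<close> to
    \<open>y\<close>, and \<open>x\<close> enters only through its square, so the equation transfers
    to natural numbers.\<close>
  have "y ^ n > 0" unfolding xy(3)[symmetric] by (simp add: add_nonneg_pos)
  then have "y > 0" using \<open>odd n\<close> assms(2) by (simp add: zero_less_power_eq)
  then have "int (7 * (nat \<bar>x\<bar>)\<^sup>2 + 1) = int (nat y ^ n)" using xy by simp
  then have "7 * (nat \<bar>x\<bar>)\<^sup>2 + 1 = nat y ^ n" by (simp only: of_nat_eq_iff)
  moreover have "even (nat y)" using xy \<open>y > 0\<close> by (simp add: even_nat_iff)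
  ultimately show False
    using no_solution_nat[OF assms, of "nat y" "nat \<bar>x\<bar>"] xy \<open>y > 0\<close> by simp
qed

end
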